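(* Let $\theta\in\mathbb{R}$ with $|\theta|<\pi/2$ and let $\gamma>0$. If $f\in\mathcal{C}_\theta(\gamma)$, then the Schwarzian derivative of $f$ satisfies $$|S_f(z)|\le \frac{\gamma\cos\theta\,\sqrt{4+(\gamma^2+4\gamma)\cos^2\theta}}{2(1-|z|)^2}\qquad (z\in\mathbb{D}).$$ Moreover, equality occurs for the function $f_1$ defined by $$f_1(z)=\frac{1-(1-z)^{\gamma e^{-i\theta}\cos\theta+1}}{\gamma e^{-i\theta}\cos\theta+1}.$$
   Context: $\mathbb{D}=\{z\in\mathbb{C}:|z|<1\}$. $\mathcal{A}$ is the class of analytic functions $f$ in $\mathbb{D}$ with $f(0)=f'(0)-1=0$. For $|\theta|<\pi/2$ and $\gamma>0$, $\mathcal{C}_\theta(\gamma)$ is the class of all $f\in\mathcal{A}$ (with $f'$ non-vanishing in $\mathbb{D}$) such that $$\operatorname{Re}\left(e^{i\theta}\left(1+\frac{zf''(z)}{f'(z)}\right)\right)<\left(1+\frac{\gamma}{2}\right)\cos\theta\quad\text{for all } z\in\mathbb{D}.$$ For a locally univalent analytic function $f$, the Schwarzian derivative is $S_f=\left(\frac{f''}{f'}\right)'-\frac12\left(\frac{f''}{f'}\right)^2$. The power of $1-z$ denotes the principal branch. *)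

theory Defs
  imports "HOL-Complex_Analysis.Complex_Analysis"
begin

abbreviation unit_disc :: "complex set" where
  "unit_disc \<equiv> ball 0 1"

text \<open>Functions on the disc are total functions on the complex plane; since the disc is open,
  their values outside it are irrelevant to membership in the classes below.\<close>

definition class_A :: "(complex \<Rightarrow> complex) set" where
  "class_A = {f. f analytic_on unit_disc \<and> f 0 = 0 \<and> deriv f 0 - 1 = 0}"

definition class_C :: "real \<Rightarrow> real \<Rightarrow> (complex \<Rightarrow> complex) set" where
  "class_C \<theta> \<gamma> = {f \<in> class_A.
     (\<forall>z\<in>unit_disc. deriv f z \<noteq> 0) \<and>
     (\<forall>z\<in>unit_disc.
        Re (exp (\<i> * of_real \<theta>) * (1 + z * deriv (deriv f) z / deriv f z))
          < (1 + \<gamma> / 2) * cos \<theta>)}"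

definition schwarzian :: "(complex \<Rightarrow> complex) \<Rightarrow> complex \<Rightarrow> complex" where
  "schwarzian f z =
     deriv (\<lambda>w. deriv (deriv f) w / deriv f w) z - 1 / 2 * (deriv (deriv f) z / deriv f z)\<^sup>2"

text \<open>The exponent has real part at least \<open>1\<close> whenever \<open>\<gamma> > 0\<close>, so the denominator is
  nonzero; \<open>powr\<close> on \<open>complex\<close> uses the principal branch of the logarithm.\<close>

definition extremal_f1 :: "real \<Rightarrow> real \<Rightarrow> complex \<Rightarrow> complex" where
  "extremal_f1 \<theta> \<gamma> z =
     (1 - (1 - z) powr (of_real \<gamma> * exp (- \<i> * of_real \<theta>) * of_real (cos \<theta>) + 1))
       / (of_real \<gamma> * exp (- \<i> * of_real \<theta>) * of_real (cos \<theta>) + 1)"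

end

theory Submission
  imports Defs
begin

text \<open>Put \<open>P = f'' / f'\<close> and \<open>c = \<gamma> cos \<theta> exp (-\<i>\<theta>)\<close>. The half-plane condition says
  \<open>|z P| < |z P - c|\<close>, so by the Schwarz lemma \<open>P = - c \<omega> / (1 - z \<omega>)\<close> with \<open>\<omega>\<close> holomorphic and
  \<open>|\<omega>| \<le> 1\<close>. Then \<open>S = - c (\<omega>' + (1 + c / 2) \<omega>\<^sup>2) / (1 - z \<omega>)\<^sup>2\<close>, and the Schwarz--Pick estimate
  of \<open>\<omega>'\<close> together with \<open>|1 + c / 2| \<ge> 1\<close> yields a bound that is largest at \<open>|\<omega>| = 1\<close>.
  The extremal function is the case \<open>\<omega> = 1\<close>.\<close>

section \<open>Schwarz--Pick estimates on the unit disc\<close>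

lemma Moebius_function_has_field_derivative:
  assumes "1 - cnj w * z \<noteq> 0"
  shows "(Moebius_function 0 w has_field_derivative
           of_real (1 - (cmod w)\<^sup>2) / (1 - cnj w * z)\<^sup>2) (at z)"
proof -
  have "(Moebius_function 0 w has_field_derivative
           (1 * (1 - cnj w * z) - (z - w) * (- cnj w)) / ((1 - cnj w * z) * (1 - cnj w * z))) (at z)"
    unfolding Moebius_function_simple[abs_def] using assms
    by (auto intro!: derivative_eq_intros)
  moreover have "1 * (1 - cnj w * z) - (z - w) * (- cnj w) = of_real (1 - (cmod w)\<^sup>2)"
    by (simp add: complex_norm_square algebra_simps del: of_real_power)
  ultimately show ?thesis
    by (simp only: power2_eq_square)
qed

text \<open>Disc automorphisms before and after \<open>g\<close> carry 0 to \<open>z0\<close> and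
  \<open>g z0\<close> to 0. The Schwarz lemma bounds the derivative of the composite
  \<open>F\<close> at 0 by 1, and the chain rule turns this into the estimate for
  \<open>g\<close>.\<close>

lemma Schwarz_Pick_ball:
  assumes holg: "g holomorphic_on ball 0 1"
    and less: "\<And>z. cmod z < 1 \<Longrightarrow> cmod (g z) < 1"
    and z0: "cmod z0 < 1"
  shows "cmod (deriv g z0) \<le> (1 - (cmod (g z0))\<^sup>2) / (1 - (cmod z0)\<^sup>2)"
proof -
  let ?M = "Moebius_function 0"
  define b where "b = g z0"
  define F where "F = ?M b \<circ> (g \<circ> ?M (- z0))"
  have b: "cmod b < 1"
    using less z0 by (simp add: b_def)
  have M0: "?M (- z0) 0 = z0"
    by (simp add: Moebius_function_of_zero)
  have "cmod (cnj b * b) < 1"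
    using b norm_mult_less[of "cnj b" 1 b 1] by simp
  then have nz: "1 - cnj b * b \<noteq> 0"
    by (metis eq_iff_diff_eq_0 less_irrefl norm_one)
  have "F holomorphic_on ball 0 1"
    unfolding F_def
    by (intro holomorphic_on_compose_gen[where t = "ball 0 1"] holg Moebius_function_holomorphic)
       (use z0 b less Moebius_function_norm_lt_1 in auto)
  moreover have "F 0 = 0"
    by (simp add: F_def M0 b_def Moebius_function_eq_zero)
  moreover have "cmod (F z) < 1" if "cmod z < 1" for z
    using that z0 b less Moebius_function_norm_lt_1 by (simp add: F_def)
  ultimately have F': "cmod (deriv F 0) \<le> 1"
    using Schwarz_Lemma(2)[of F 0] by simp
  have "(g has_field_derivative deriv g z0) (at (?M (- z0) 0))"
    using holg z0 by (auto simp: M0 intro!: holomorphic_derivI[where S = "ball 0 1"])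
  moreover have "(?M (- z0) has_field_derivative of_real (1 - (cmod z0)\<^sup>2)) (at 0)"
    using Moebius_function_has_field_derivative[of "- z0" 0] by simp
  ultimately have inner: "((g \<circ> ?M (- z0)) has_field_derivative
      deriv g z0 * of_real (1 - (cmod z0)\<^sup>2)) (at 0)"
    by (rule DERIV_chain)
  have outer: "(?M b has_field_derivative of_real (1 - (cmod b)\<^sup>2) / (1 - cnj b * b)\<^sup>2)
      (at ((g \<circ> ?M (- z0)) 0))"
    using Moebius_function_has_field_derivative[OF nz] by (simp add: M0 b_def)
  have "(F has_field_derivative of_real (1 - (cmod b)\<^sup>2) / (1 - cnj b * b)\<^sup>2 *
      (deriv g z0 * of_real (1 - (cmod z0)\<^sup>2))) (at 0)"
    unfolding F_def by (rule DERIV_chain[OF outer inner])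
  then have "deriv F 0 = of_real (1 - (cmod b)\<^sup>2) / (1 - cnj b * b)\<^sup>2 *
      (deriv g z0 * of_real (1 - (cmod z0)\<^sup>2))"
    by (rule DERIV_imp_deriv)
  \<comment> \<open>The squared denominator is thus the square of the real numerator, so one factor
    cancels.\<close>
  moreover have "1 - cnj b * b = of_real (1 - (cmod b)\<^sup>2)"
    by (simp add: complex_norm_square mult.commute del: of_real_power)
  moreover have pos: "0 < 1 - (cmod b)\<^sup>2" "0 < 1 - (cmod z0)\<^sup>2"
    using b z0 by (simp_all add: power_less_one_iff abs_square_less_1)
  ultimately have "cmod (deriv F 0) = cmod (deriv g z0) * (1 - (cmod z0)\<^sup>2) / (1 - (cmod b)\<^sup>2)"
    by (simp add: norm_mult norm_divide norm_power power2_eq_square del: of_real_diff of_real_power)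
  with F' pos show ?thesis
    by (simp add: b_def field_simps)
qed

text \<open>The function \<open>\<omega>\<close> obtained below may have modulus 1 inside the disc,
  as it does in the extremal case. Then the maximum modulus principle makes it constant and both
  sides vanish; otherwise the strict version applies.\<close>

lemma Schwarz_Pick_cball:
  assumes holg: "g holomorphic_on ball 0 1"
    and le: "\<And>z. cmod z < 1 \<Longrightarrow> cmod (g z) \<le> 1"
    and z0: "cmod z0 < 1"
  shows "cmod (deriv g z0) \<le> (1 - (cmod (g z0))\<^sup>2) / (1 - (cmod z0)\<^sup>2)"
proof (cases "\<exists>w. cmod w < 1 \<and> cmod (g w) = 1")
  case False
  then have "cmod (g z) < 1" if "cmod z < 1" for z
    using le that by (meson order_less_le)
  then show ?thesis
    by (rule Schwarz_Pick_ball[OF holg _ z0])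
next
  case True
  then obtain w where w: "cmod w < 1" "cmod (g w) = 1"
    by blast
  have sub: "ball w (1 - cmod w) \<subseteq> ball 0 1"
  proof
    fix v assume "v \<in> ball w (1 - cmod w)"
    then show "v \<in> ball 0 1"
      using norm_triangle_sub[of v w] by (simp add: dist_norm norm_minus_commute[of w v])
  qed
  then have "cmod (g z) \<le> cmod (g w)" if "cmod (w - z) < 1 - cmod w" for z
    using that le w by (auto simp: dist_norm)
  then have "g constant_on ball 0 1"
    using Schwarz2[OF holg _ sub] w by simp
  then obtain k where k: "\<And>z. z \<in> ball 0 1 \<Longrightarrow> g z = k"
    by (auto simp: constant_on_def)
  then have "deriv g z0 = deriv (\<lambda>_. k) z0"
    using z0 by (intro deriv_cong_ev eventually_nhds_in_open[THEN eventually_mono, of "ball 0 1"]) auto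
  moreover have "(1 - (cmod (g z0))\<^sup>2) / (1 - (cmod z0)\<^sup>2) = 0"
    using k[of w] k[of z0] w z0 by simp
  ultimately show ?thesis
    by (simp only: deriv_const norm_zero order_refl)
qed

section \<open>Representation by a bounded function and the resulting Schwarzian bound\<close>

text \<open>With q = z P the function q / (q - c) maps the disc into itself and vanishes at 0. Hence
  it is z times a function \<open>\<omega>\<close> bounded by 1, and solving for P gives the
  formula.\<close>

lemma subordination_representation:
  assumes holP: "P holomorphic_on ball 0 1"
    and less: "\<And>z. cmod z < 1 \<Longrightarrow> cmod (z * P z) < cmod (z * P z - c)"
  obtains \<omega> where "\<omega> holomorphic_on ball 0 1" "\<And>z. cmod z < 1 \<Longrightarrow> cmod (\<omega> z) \<le> 1"
    "\<And>z. cmod z < 1 \<Longrightarrow> P z = - c * \<omega> z / (1 - z * \<omega> z)"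
proof
  define \<omega> where "\<omega> = (\<lambda>z. P z / (z * P z - c))"
  have nz: "z * P z - c \<noteq> 0" if "cmod z < 1" for z
    using less[OF that] by auto
  show hol: "\<omega> holomorphic_on ball 0 1"
    unfolding \<omega>_def using nz by (intro holomorphic_intros holP) auto
  have hol': "(\<lambda>z. z * \<omega> z) holomorphic_on ball 0 1"
    by (intro holomorphic_intros hol)
  have less1: "cmod (z * \<omega> z) < 1" if "cmod z < 1" for z
    using less[OF that] nz[OF that] by (simp add: \<omega>_def norm_divide)
  \<comment> \<open>Dividing the Schwarz bound by |z| fails at the origin. There
    \<open>\<omega> 0\<close> is the derivative of z \<open>\<omega>\<close>, which the Schwarz
    lemma also bounds by 1.\<close>
  have "((\<lambda>z. z * \<omega> z) has_field_derivative 0 * deriv \<omega> 0 + 1 * \<omega> 0) (at 0)"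
    by (rule DERIV_cong[OF DERIV_mult[OF DERIV_ident holomorphic_derivI[OF hol]]]) auto
  then have deriv0: "deriv (\<lambda>z. z * \<omega> z) 0 = \<omega> 0"
    using DERIV_imp_deriv by fastforce
  show "cmod (\<omega> z) \<le> 1" if z: "cmod z < 1" for z
  proof (cases "z = 0")
    case True
    then show ?thesis
      using Schwarz_Lemma(2)[OF hol' _ less1 z] deriv0 by simp
  next
    case False
    then show ?thesis
      using Schwarz_Lemma(1)[OF hol' _ less1 z] by (simp add: norm_mult)
  qed
  show "P z = - c * \<omega> z / (1 - z * \<omega> z)" if z: "cmod z < 1" for z
  proof -
    have "1 - z * \<omega> z \<noteq> 0"
      using less1[OF z] by (metis eq_iff_diff_eq_0 less_irrefl norm_one)
    moreover have "P z * (1 - z * \<omega> z) = - c * \<omega> z"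
      using nz[OF z] by (simp add: \<omega>_def field_simps)
    ultimately show ?thesis
      by (simp add: field_simps)
  qed
qed

text \<open>After cancelling \<open>1 - x\<close> the case \<open>M = 1\<close> reduces to \<open>0 \<le> 2 r (1 - r x)\<close>.\<close>
lemma Pick_bound_le:
  fixes r x M :: real
  assumes "0 \<le> r" "r < 1" "0 \<le> x" "x \<le> 1" "1 \<le> M"
  shows "((1 - x\<^sup>2) / (1 - r\<^sup>2) + M * x\<^sup>2) / (1 - r * x)\<^sup>2 \<le> M / (1 - r)\<^sup>2"
proof -
  have rx: "r * x < 1"
    using assms by (meson mult_left_le order_le_less_trans)
  have "(1 - x) * ((1 + x) * (1 - r)) \<le> (1 - x) * ((1 + x - 2 * r * x) * (1 + r))"
  proof (rule mult_left_mono)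
    have "0 \<le> 2 * r * (1 - r * x)"
      using assms rx by simp
    then show "(1 + x) * (1 - r) \<le> (1 + x - 2 * r * x) * (1 + r)"
      by (simp add: algebra_simps)
  qed (use assms in simp)
  \<comment> \<open>The difference of squares factors as (1 - x) (1 + x - 2 r x).\<close>
  then have "(1 - x\<^sup>2) * (1 - r) \<le> ((1 - r * x)\<^sup>2 - x\<^sup>2 * (1 - r)\<^sup>2) * (1 + r)"
    by (simp add: algebra_simps power2_eq_square)
  then have "(1 - x\<^sup>2) * (1 - r) / (1 + r) \<le> (1 - r * x)\<^sup>2 - x\<^sup>2 * (1 - r)\<^sup>2"
    using assms by (simp add: pos_divide_le_eq)
  moreover have "(1 - x\<^sup>2) / (1 - r\<^sup>2) * (1 - r)\<^sup>2 = (1 - x\<^sup>2) * (1 - r) / (1 + r)"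
  proof -
    have "1 - r\<^sup>2 = (1 - r) * (1 + r)"
      by (simp add: algebra_simps power2_eq_square)
    then show ?thesis
      using assms by (simp add: power2_eq_square)
  qed
  ultimately have "(1 - x\<^sup>2) / (1 - r\<^sup>2) * (1 - r)\<^sup>2 \<le> (1 - r * x)\<^sup>2 - x\<^sup>2 * (1 - r)\<^sup>2"
    by simp
  \<comment> \<open>The bracket is nonnegative because x (1 - r) \<le> 1 - r x, so a factor M \<ge>
    1 can only enlarge it.\<close>
  also have "\<dots> \<le> M * ((1 - r * x)\<^sup>2 - x\<^sup>2 * (1 - r)\<^sup>2)"
  proof -
    have "x * (1 - r) \<le> 1 - r * x"
      using assms by (simp add: algebra_simps)
    then have "(x * (1 - r))\<^sup>2 \<le> (1 - r * x)\<^sup>2"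
      using assms by (intro power_mono) auto
    then show ?thesis
      using mult_right_mono[of 1 M "(1 - r * x)\<^sup>2 - x\<^sup>2 * (1 - r)\<^sup>2"] assms
      by (simp add: power_mult_distrib)
  qed
  finally have "((1 - x\<^sup>2) / (1 - r\<^sup>2) + M * x\<^sup>2) * (1 - r)\<^sup>2 \<le> M * (1 - r * x)\<^sup>2"
    by (simp add: algebra_simps)
  then show ?thesis
    using assms rx by (simp add: divide_le_eq pos_le_divide_eq mult.commute)
qed

text \<open>Kept in free letters to serve twice: with A = \<open>\<omega>\<close>' +
  \<open>\<omega>\<close>^2, u = \<open>\<omega>\<close> and d = 1 - z \<open>\<omega>\<close> for
  the general bound, and with A = u = 1 and d = 1 - z for the extremal function.\<close>

lemma schwarzian_form_eq:
  fixes A c u d :: complex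
  shows "- c * A / d\<^sup>2 - 1 / 2 * (- c * u / d)\<^sup>2 = - c * (A + c / 2 * u\<^sup>2) / d\<^sup>2"
proof -
  have "- c * (A + c / 2 * u\<^sup>2) = - c * A - 1 / 2 * (- c * u)\<^sup>2"
    by (simp add: power2_eq_square algebra_simps)
  then show ?thesis
    by (simp only: power_divide diff_divide_distrib times_divide_eq_right)
qed

lemma schwarzian_form_le:
  assumes holP: "P holomorphic_on ball 0 1"
    and less: "\<And>z. cmod z < 1 \<Longrightarrow> cmod (z * P z) < cmod (z * P z - c)"
    and M: "1 \<le> cmod (1 + c / 2)" and z: "cmod z < 1"
  shows "cmod (deriv P z - 1 / 2 * (P z)\<^sup>2) \<le> cmod c * cmod (1 + c / 2) / (1 - cmod z)\<^sup>2"
proof -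
  obtain \<omega> where hol: "\<omega> holomorphic_on ball 0 1"
    and le: "\<And>z. cmod z < 1 \<Longrightarrow> cmod (\<omega> z) \<le> 1"
    and P: "\<And>z. cmod z < 1 \<Longrightarrow> P z = - c * \<omega> z / (1 - z * \<omega> z)"
    using subordination_representation[OF holP less] by blast
  define r where "r = cmod z"
  define x where "x = cmod (\<omega> z)"
  have rx: "r * x < 1"
    using z le[OF z] unfolding r_def x_def by (meson mult_left_le norm_ge_zero order_le_less_trans)
  have low: "1 - r * x \<le> cmod (1 - z * \<omega> z)"
    using norm_triangle_ineq2[of 1 "z * \<omega> z"] by (simp add: r_def x_def norm_mult)
  then have nz: "1 - z * \<omega> z \<noteq> 0"
    using rx by auto
  have d\<omega>: "(\<omega> has_field_derivative deriv \<omega> z) (at z)"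
    using z by (intro holomorphic_derivI[OF hol]) auto
  have num: "((\<lambda>z. - c * \<omega> z) has_field_derivative - c * deriv \<omega> z) (at z)"
    by (intro DERIV_cmult d\<omega>)
  have den: "((\<lambda>z. 1 - z * \<omega> z) has_field_derivative - (\<omega> z + z * deriv \<omega> z)) (at z)"
    by (auto intro!: derivative_eq_intros d\<omega>)
  \<comment> \<open>In the numerator of the quotient rule the terms with z \<open>\<omega>\<close>
    \<open>\<omega>\<close>' cancel.\<close>
  have "- c * deriv \<omega> z * (1 - z * \<omega> z) - (- c * \<omega> z) * (- (\<omega> z + z * deriv \<omega> z))
      = - c * (deriv \<omega> z + (\<omega> z)\<^sup>2)"
    by (simp add: power2_eq_square algebra_simps)
  then have "((\<lambda>z. - c * \<omega> z / (1 - z * \<omega> z)) has_field_derivative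
      - c * (deriv \<omega> z + (\<omega> z)\<^sup>2) / (1 - z * \<omega> z)\<^sup>2) (at z)"
    using DERIV_divide[OF num den nz] by (simp only: power2_eq_square)
  then have "(P has_field_derivative
      - c * (deriv \<omega> z + (\<omega> z)\<^sup>2) / (1 - z * \<omega> z)\<^sup>2) (at z)"
    by (rule has_field_derivative_transform_within_open[where S = "ball 0 1"]) (use z P in auto)
  then have "deriv P z = - c * (deriv \<omega> z + (\<omega> z)\<^sup>2) / (1 - z * \<omega> z)\<^sup>2"
    by (rule DERIV_imp_deriv)
  then have "deriv P z - 1 / 2 * (P z)\<^sup>2 =
      - c * (deriv \<omega> z + (1 + c / 2) * (\<omega> z)\<^sup>2) / (1 - z * \<omega> z)\<^sup>2"
    unfolding P[OF z] by (simp only: schwarzian_form_eq) (simp add: algebra_simps)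
  then have "cmod (deriv P z - 1 / 2 * (P z)\<^sup>2) =
      cmod c * (cmod (deriv \<omega> z + (1 + c / 2) * (\<omega> z)\<^sup>2) / (cmod (1 - z * \<omega> z))\<^sup>2)"
    by (simp add: norm_mult norm_divide norm_power)
  \<comment> \<open>Schwarz--Pick bounds the numerator and |1 - z \<open>\<omega>\<close>| \<ge> 1 -
    r x the denominator, which leaves a problem in the two real variables r and x.\<close>
  also have "\<dots> \<le> cmod c * (((1 - x\<^sup>2) / (1 - r\<^sup>2) + cmod (1 + c / 2) * x\<^sup>2) / (1 - r * x)\<^sup>2)"
  proof (intro mult_left_mono frac_le power_mono)
    show "cmod (deriv \<omega> z + (1 + c / 2) * (\<omega> z)\<^sup>2) \<le> (1 - x\<^sup>2) / (1 - r\<^sup>2) + cmod (1 + c / 2) * x\<^sup>2"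
      using norm_triangle_ineq[of "deriv \<omega> z" "(1 + c / 2) * (\<omega> z)\<^sup>2"]
        Schwarz_Pick_cball[OF hol le z]
      by (simp add: norm_mult norm_power x_def r_def)
    then show "0 \<le> (1 - x\<^sup>2) / (1 - r\<^sup>2) + cmod (1 + c / 2) * x\<^sup>2"
      by (rule order_trans[OF norm_ge_zero])
  qed (use rx low in auto)
  also have "\<dots> \<le> cmod c * (cmod (1 + c / 2) / (1 - r)\<^sup>2)"
    using z le[OF z] M by (intro mult_left_mono Pick_bound_le) (auto simp: r_def x_def)
  finally show ?thesis
    by (simp add: r_def)
qed

section \<open>The coefficient c and the half-plane condition\<close>

lemma cmod_less_cmod_diff_iff:
  "cmod q < cmod (q - of_real a) \<longleftrightarrow> 2 * (a * Re q) < a\<^sup>2"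
proof -
  have "cmod q < cmod (q - of_real a) \<longleftrightarrow> (cmod q)\<^sup>2 < (cmod (q - of_real a))\<^sup>2"
    by (meson norm_ge_zero pos2 power_mono_iff linorder_not_le)
  also have "\<dots> \<longleftrightarrow> 2 * (a * Re q) < a\<^sup>2"
    unfolding cmod_power2 by (simp add: power2_eq_square algebra_simps)
  finally show ?thesis .
qed

text \<open>The number c of the overview. The body repeats a subterm of \<open>extremal_f1\<close>
  literally, so that the exponent there folds to c + 1.\<close>

definition spiral_coeff :: "real \<Rightarrow> real \<Rightarrow> complex" where
  "spiral_coeff \<theta> \<gamma> = of_real \<gamma> * exp (- \<i> * of_real \<theta>) * of_real (cos \<theta>)"

lemma Re_spiral_coeff: "Re (spiral_coeff \<theta> \<gamma>) = \<gamma> * (cos \<theta>)\<^sup>2"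
  by (simp add: spiral_coeff_def Re_exp power2_eq_square)

lemma exp_mult_spiral_coeff: "exp (\<i> * of_real \<theta>) * spiral_coeff \<theta> \<gamma> = of_real (\<gamma> * cos \<theta>)"
  by (simp add: spiral_coeff_def exp_minus)

lemma cmod_spiral_coeff: "cmod (spiral_coeff \<theta> \<gamma>) = \<bar>\<gamma> * cos \<theta>\<bar>"
  by (simp add: spiral_coeff_def norm_mult abs_mult)

text \<open>This is the origin of the square root in the bound: |1 + c/2|^2 = 1 + Re c + |c|^2 /
  4.\<close>

lemma cmod_one_plus_half_spiral_coeff:
  "cmod (1 + spiral_coeff \<theta> \<gamma> / 2) = sqrt (4 + (\<gamma>\<^sup>2 + 4 * \<gamma>) * (cos \<theta>)\<^sup>2) / 2"
proof -
  have "(cmod (1 + spiral_coeff \<theta> \<gamma> / 2))\<^sup>2 =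
      1 + Re (spiral_coeff \<theta> \<gamma>) + (cmod (spiral_coeff \<theta> \<gamma>))\<^sup>2 / 4"
    unfolding cmod_power2 by (simp add: power2_eq_square field_simps)
  also have "\<dots> = (4 + (\<gamma>\<^sup>2 + 4 * \<gamma>) * (cos \<theta>)\<^sup>2) / 2\<^sup>2"
    by (simp add: Re_spiral_coeff cmod_spiral_coeff power_mult_distrib field_simps)
  finally have "cmod (1 + spiral_coeff \<theta> \<gamma> / 2) = sqrt ((4 + (\<gamma>\<^sup>2 + 4 * \<gamma>) * (cos \<theta>)\<^sup>2) / 2\<^sup>2)"
    by (simp only: real_sqrt_unique norm_ge_zero)
  then show ?thesis
    by (simp add: real_sqrt_divide)
qed

text \<open>Rotation by exp(i \<theta>) preserves moduli and moves c to the real point \<gamma> cos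
  \<theta>. Being closer to 0 than to that point is a half-plane condition, and the summand 1
  contributes cos \<theta> to both sides.\<close>

lemma class_C_condition_iff:
  assumes "\<gamma> * cos \<theta> > 0"
  shows "Re (exp (\<i> * of_real \<theta>) * (1 + w)) < (1 + \<gamma> / 2) * cos \<theta> \<longleftrightarrow>
           cmod w < cmod (w - spiral_coeff \<theta> \<gamma>)"
proof -
  let ?E = "exp (\<i> * of_real \<theta>)"
  have "cmod w < cmod (w - spiral_coeff \<theta> \<gamma>) \<longleftrightarrow>
      cmod (?E * w) < cmod (?E * w - of_real (\<gamma> * cos \<theta>))"
    unfolding exp_mult_spiral_coeff[symmetric] right_diff_distrib[symmetric] norm_mult by simp
  also have "\<dots> \<longleftrightarrow> (\<gamma> * cos \<theta>) * (2 * Re (?E * w)) < (\<gamma> * cos \<theta>) * (\<gamma> * cos \<theta>)"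
    unfolding cmod_less_cmod_diff_iff by (simp only: power2_eq_square ac_simps)
  also have "\<dots> \<longleftrightarrow> 2 * Re (?E * w) < \<gamma> * cos \<theta>"
    using assms by (rule mult_less_cancel_left_pos)
  also have "\<dots> \<longleftrightarrow> Re (?E * (1 + w)) < (1 + \<gamma> / 2) * cos \<theta>"
    by (simp add: Re_exp field_simps)
  finally show ?thesis
    by blast
qed

lemma schwarzian_class_C_le:
  assumes "\<gamma> > 0" "cos \<theta> > 0" "f \<in> class_C \<theta> \<gamma>" "cmod z < 1"
  shows "cmod (schwarzian f z)
           \<le> cmod (spiral_coeff \<theta> \<gamma>) * cmod (1 + spiral_coeff \<theta> \<gamma> / 2) / (1 - cmod z)\<^sup>2"
  unfolding schwarzian_def
proof (rule schwarzian_form_le)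
  have f: "f holomorphic_on ball 0 1" and nz: "\<And>z. z \<in> ball 0 1 \<Longrightarrow> deriv f z \<noteq> 0"
    using assms by (auto simp: class_C_def class_A_def analytic_imp_holomorphic)
  show "(\<lambda>w. deriv (deriv f) w / deriv f w) holomorphic_on ball 0 1"
    using nz by (intro holomorphic_intros holomorphic_deriv f) auto
  show "cmod (w * (deriv (deriv f) w / deriv f w))
      < cmod (w * (deriv (deriv f) w / deriv f w) - spiral_coeff \<theta> \<gamma>)" if "cmod w < 1" for w
    using assms that class_C_condition_iff[of \<gamma> \<theta> "w * (deriv (deriv f) w / deriv f w)"]
    by (simp add: class_C_def)
  have "1 \<le> Re (1 + spiral_coeff \<theta> \<gamma> / 2)"
    using assms by (simp add: Re_spiral_coeff)
  then show "1 \<le> cmod (1 + spiral_coeff \<theta> \<gamma> / 2)"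
    by (rule order_trans[OF _ complex_Re_le_cmod])
qed (use assms in simp)

section \<open>The extremal function\<close>

text \<open>Keeps 1 - z off the branch cut, so that its principal powers are differentiable on the
  disc.\<close>

lemma one_minus_notin_nonpos_Reals:
  assumes "cmod z < 1"
  shows "1 - z \<notin> \<real>\<^sub>\<le>\<^sub>0"
proof -
  have "Re z < 1"
    using assms complex_Re_le_cmod[of z] by simp
  then show ?thesis
    by (auto simp: complex_nonpos_Reals_iff)
qed

lemma extremal_f1_has_field_derivative:
  assumes "\<gamma> \<ge> 0" "cmod z < 1"
  shows "(extremal_f1 \<theta> \<gamma> has_field_derivative (1 - z) powr spiral_coeff \<theta> \<gamma>) (at z)"
proof -
  let ?c = "spiral_coeff \<theta> \<gamma>"
  have "Re (?c + 1) > 0"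
    using assms by (simp add: Re_spiral_coeff add_nonneg_pos)
  then have nz: "?c + 1 \<noteq> 0"
    by (auto simp: complex_eq_iff)
  show ?thesis
    unfolding extremal_f1_def[abs_def] spiral_coeff_def[symmetric]
    using nz one_minus_notin_nonpos_Reals[OF assms(2)]
    by (auto intro!: derivative_eq_intros)
qed

lemma deriv_extremal_f1:
  assumes "\<gamma> \<ge> 0" "cmod z < 1"
  shows "deriv (extremal_f1 \<theta> \<gamma>) z = (1 - z) powr spiral_coeff \<theta> \<gamma>"
  using extremal_f1_has_field_derivative[OF assms] by (rule DERIV_imp_deriv)

text \<open>This is the representation of P with \<open>\<omega>\<close> = 1.\<close>

lemma deriv2_extremal_f1:
  assumes "\<gamma> \<ge> 0" "cmod z < 1"
  shows "deriv (deriv (extremal_f1 \<theta> \<gamma>)) z / deriv (extremal_f1 \<theta> \<gamma>) z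
           = - spiral_coeff \<theta> \<gamma> / (1 - z)"
proof -
  let ?c = "spiral_coeff \<theta> \<gamma>"
  have nz: "1 - z \<noteq> 0"
    using assms by auto
  have "((\<lambda>w. (1 - w) powr ?c) has_field_derivative - ?c * (1 - z) powr (?c - 1)) (at z)"
    using one_minus_notin_nonpos_Reals[OF assms(2)] by (auto intro!: derivative_eq_intros)
  then have "(deriv (extremal_f1 \<theta> \<gamma>) has_field_derivative - ?c * (1 - z) powr (?c - 1)) (at z)"
    by (rule has_field_derivative_transform_within_open[where S = "ball 0 1"])
       (use assms deriv_extremal_f1 in auto)
  then have "deriv (deriv (extremal_f1 \<theta> \<gamma>)) z = - ?c * (1 - z) powr (?c - 1)"
    by (rule DERIV_imp_deriv)
  then show ?thesis
    using nz by (simp add: deriv_extremal_f1[OF assms] powr_diff field_simps)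
qed

lemma extremal_f1_in_class_C:
  assumes "\<gamma> > 0" "cos \<theta> > 0"
  shows "extremal_f1 \<theta> \<gamma> \<in> class_C \<theta> \<gamma>"
  unfolding class_C_def class_A_def
proof (intro CollectI conjI ballI)
  let ?f = "extremal_f1 \<theta> \<gamma>" and ?c = "spiral_coeff \<theta> \<gamma>"
  have "?f holomorphic_on unit_disc"
    unfolding holomorphic_on_open[OF open_ball]
    using extremal_f1_has_field_derivative[OF less_imp_le[OF assms(1)]] by (metis mem_ball_0)
  then show "?f analytic_on unit_disc"
    by (simp add: analytic_on_open)
  show "?f 0 = 0"
    by (simp add: extremal_f1_def)
  show "deriv ?f 0 - 1 = 0"
    using assms by (simp add: deriv_extremal_f1)
next
  fix z :: complex
  assume "z \<in> unit_disc"
  then show "deriv (extremal_f1 \<theta> \<gamma>) z \<noteq> 0"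
    using assms by (auto simp: deriv_extremal_f1)
next
  fix z :: complex
  assume "z \<in> unit_disc"
  then have z: "cmod z < 1" and nz: "1 - z \<noteq> 0"
    by auto
  let ?f = "extremal_f1 \<theta> \<gamma>" and ?c = "spiral_coeff \<theta> \<gamma>"
  have c: "cmod ?c > 0"
    using assms by (simp add: cmod_spiral_coeff)
  have "z * deriv (deriv ?f) z / deriv ?f z = - ?c * z / (1 - z)"
    using deriv2_extremal_f1[OF less_imp_le[OF assms(1)] z, of \<theta>]
    by (simp only: times_divide_eq_right[symmetric] mult.commute)
  moreover have "cmod (- ?c * z / (1 - z)) < cmod (- ?c * z / (1 - z) - ?c)"
  proof -
    \<comment> \<open>Both moduli now have the factor |c| / |1 - z|, and the claim is just |z| <
      1.\<close>
    have "- ?c * z / (1 - z) - ?c = - ?c / (1 - z)"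
      using nz by (simp add: field_simps)
    then show ?thesis
      using c z nz by (simp add: norm_divide norm_mult divide_strict_right_mono)
  qed
  ultimately show "Re (exp (\<i> * of_real \<theta>) * (1 + z * deriv (deriv ?f) z / deriv ?f z))
      < (1 + \<gamma> / 2) * cos \<theta>"
    using assms by (simp only: class_C_condition_iff mult_pos_pos)
qed

lemma schwarzian_extremal_f1:
  assumes "\<gamma> \<ge> 0" "cmod z < 1"
  shows "schwarzian (extremal_f1 \<theta> \<gamma>) z
           = - spiral_coeff \<theta> \<gamma> * (1 + spiral_coeff \<theta> \<gamma> / 2) / (1 - z)\<^sup>2"
proof -
  let ?c = "spiral_coeff \<theta> \<gamma>"
  have nz: "1 - z \<noteq> 0"
    using assms by auto
  then have "((\<lambda>w. - ?c / (1 - w)) has_field_derivative - ?c / (1 - z)\<^sup>2) (at z)"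
    by (auto intro!: derivative_eq_intros simp: power2_eq_square)
  then have "((\<lambda>w. deriv (deriv (extremal_f1 \<theta> \<gamma>)) w / deriv (extremal_f1 \<theta> \<gamma>) w)
      has_field_derivative - ?c / (1 - z)\<^sup>2) (at z)"
    by (rule has_field_derivative_transform_within_open[where S = "ball 0 1"])
       (use assms deriv2_extremal_f1 in auto)
  then have "deriv (\<lambda>w. deriv (deriv (extremal_f1 \<theta> \<gamma>)) w / deriv (extremal_f1 \<theta> \<gamma>) w) z
      = - ?c / (1 - z)\<^sup>2"
    by (rule DERIV_imp_deriv)
  then show ?thesis
    using schwarzian_form_eq[of ?c 1 "1 - z" 1]
    unfolding schwarzian_def deriv2_extremal_f1[OF assms] by simp
qed

text \<open>The Schwarzian of the extremal function has modulus |c| |1 + c/2| / |1 - z|^2. Within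
  the disc |1 - z| = 1 - |z| holds exactly on the radius [0, 1), so equality is asserted there;
  membership in the class shows that the bound is attained within it.\<close>

theorem theorem2p1:
  fixes \<theta> \<gamma> :: real
  assumes "\<bar>\<theta>\<bar> < pi / 2" and "\<gamma> > 0"
  shows "(\<forall>f \<in> class_C \<theta> \<gamma>. \<forall>z \<in> unit_disc.
            cmod (schwarzian f z)
              \<le> \<gamma> * cos \<theta> * sqrt (4 + (\<gamma>\<^sup>2 + 4 * \<gamma>) * (cos \<theta>)\<^sup>2) / (2 * (1 - cmod z)\<^sup>2))
       \<and> extremal_f1 \<theta> \<gamma> \<in> class_C \<theta> \<gamma>
       \<and> (\<forall>r::real. 0 \<le> r \<and> r < 1 \<longrightarrow>
            cmod (schwarzian (extremal_f1 \<theta> \<gamma>) (of_real r))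
              = \<gamma> * cos \<theta> * sqrt (4 + (\<gamma>\<^sup>2 + 4 * \<gamma>) * (cos \<theta>)\<^sup>2) / (2 * (1 - cmod (of_real r :: complex))\<^sup>2))"
proof -
  have cos: "cos \<theta> > 0"
    using assms by (intro cos_gt_zero_pi) auto
  \<comment> \<open>A free denominator d lets this rewrite both the inequality and the
    equality.\<close>
  have bound: "cmod (spiral_coeff \<theta> \<gamma>) * cmod (1 + spiral_coeff \<theta> \<gamma> / 2) / d
      = \<gamma> * cos \<theta> * sqrt (4 + (\<gamma>\<^sup>2 + 4 * \<gamma>) * (cos \<theta>)\<^sup>2) / (2 * d)" for d
    using assms cos by (simp add: cmod_spiral_coeff cmod_one_plus_half_spiral_coeff)
  have "cmod (schwarzian (extremal_f1 \<theta> \<gamma>) (of_real r))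
      = cmod (spiral_coeff \<theta> \<gamma>) * cmod (1 + spiral_coeff \<theta> \<gamma> / 2) / (1 - cmod (of_real r :: complex))\<^sup>2"
    if "0 \<le> r" "r < 1" for r
  proof -
    have "cmod (1 - of_real r) = 1 - r"
      using that norm_of_real[of "1 - r", where 'a = complex] by simp
    then show ?thesis
      using that assms by (simp add: schwarzian_extremal_f1 norm_mult norm_divide norm_power)
  qed
  then show ?thesis
    using schwarzian_class_C_le[OF assms(2) cos] extremal_f1_in_class_C[OF assms(2) cos]
    unfolding bound by auto
qed

end
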